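(* There exists a set $A$ of positive integers which contains no three-term geometric progression with integer ratio and whose upper density satisfies $\bar{d}(A) > 0.815509$. Consequently $\overline{\beta} > 0.815509$.
   Context: A three-term geometric progression with integer ratio is a triple $(a, ak, ak^2)$ of positive integers with $k \geq 2$ an integer. $\bar d(A)=\limsup_{N\to\infty}|A\cap\{1,\dots,N\}|/N$ is the upper density. $\overline{\beta}$ is the supremum of $\bar{d}(A)$ over all sets $A\subset\mathbb{N}$ containing no three-term geometric progression with integer ratio. *)

theory Defs
  imports Complex_Main "HOL-Library.Extended_Real"
begin

definition int_ratio_gp_free :: "nat set \<Rightarrow> bool" where
  "int_ratio_gp_free A \<longleftrightarrow>
     \<not> (\<exists>a k. a \<ge> 1 \<and> k \<ge> 2 \<and> a \<in> A \<and> a * k \<in> A \<and> a * k ^ 2 \<in> A)"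

(* Valued in ereal, a complete lattice, so that limsup and SUP below need no
   boundedness side conditions. The term at N = 0 (a division by zero, hence 0)
   does not affect the limsup. *)
definition upper_density :: "nat set \<Rightarrow> ereal" where
  "upper_density A = limsup (\<lambda>N. ereal (real (card (A \<inter> {1..N})) / real N))"

definition beta_bar :: ereal where
  "beta_bar = (SUP A \<in> {A. A \<subseteq> {1..} \<and> int_ratio_gp_free A}. upper_density A)"

end

theory Submission
  imports Defs
begin

text \<open>
  For \<open>N = 4320 * m\<close> the union of the intervals \<open>(N/48, N/45]\<close>, \<open>(N/40, N/36]\<close>, \<open>(N/32, N/27]\<close>,
  \<open>(N/24, N/12]\<close>, \<open>(N/9, N/8]\<close> and \<open>(N/4, N]\<close> contains no progression \<open>a, a * k, a * k^2\<close>: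
  the ratio would be at most 6, and for each such ratio the intervals miss one another.
  It has \<open>3523 * m\<close> elements, a proportion of \<open>3523/4320 = 0.8155092...\<close>.
  Copies of this set at scales that grow faster than quadratically do not interact: in a
  progression \<open>a, b, c\<close> we have \<open>c \<le> a * c = b^2\<close>, so \<open>c\<close> cannot lie at a larger scale than \<open>b\<close>;
  then the ratio is less than 48, so \<open>a\<close> lies at that scale as well.
\<close>

text \<open>The factor 4320 is the least common multiple of the denominators 48, 45, 40, 36, 32, 27,
  24, 12, 9, 8 and 4, so all endpoints are integers.\<close>

definition gp_block :: "nat \<Rightarrow> nat set" where
  "gp_block m = {90*m<..96*m} \<union> {108*m<..120*m} \<union> {135*m<..160*m} \<union> {180*m<..360*m}
     \<union> {480*m<..540*m} \<union> {1080*m<..4320*m}"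

lemma gp_block_bounds:
  assumes "x \<in> gp_block m"
  shows "90 * m < x" "x \<le> 4320 * m"
  using assms by (auto simp: gp_block_def)

lemma gp_block_subset: "gp_block m \<subseteq> {1..4320 * m}"
  using gp_block_bounds by fastforce

lemma card_gp_block: "card (gp_block m) = 3523 * m"
  unfolding gp_block_def
  by (subst card_Un_disjoint; (auto simp: card_Un_disjoint)[1])+

lemma gp_block_gp_free: "int_ratio_gp_free (gp_block m)"
  unfolding int_ratio_gp_free_def
proof safe
  fix a k :: nat
  assume k: "k \<ge> 2" and a: "a \<in> gp_block m" and b: "a * k \<in> gp_block m"
    and c: "a * k ^ 2 \<in> gp_block m"
  \<comment> \<open>Any two elements have ratio below 4320/90 = 48 < 7^2.\<close>
  have "k < 7"
  proof (rule ccontr)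
    assume "\<not> k < 7"
    then have "7 ^ 2 \<le> k ^ 2" by (intro power_mono) auto
    then have "a * 49 \<le> a * k ^ 2" by (intro mult_left_mono) auto
    then show False using gp_block_bounds[OF a] gp_block_bounds[OF c] by linarith
  qed
  with k consider "k = 2" | "k = 3" | "k = 4" | "k = 5" | "k = 6" by linarith
  \<comment> \<open>For a numeral \<open>k\<close>, each choice of intervals for the three terms
    gives contradictory linear inequalities in \<open>a\<close> and \<open>m\<close>.\<close>
  then show False
    using a b c unfolding gp_block_def
    by cases (elim UnE; simp)+
qed

text \<open>Each scale \<open>s\<close> is followed by \<open>s ^ 4\<close>, which is at least
  \<open>(4320 * s) ^ 2\<close> because \<open>4320 \<le> s\<close>.\<close>

definition gp_scale :: "nat \<Rightarrow> nat" where
  "gp_scale i = 4320 ^ (4 ^ i)"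

lemma strict_mono_gp_scale: "strict_mono gp_scale"
  by (auto simp: gp_scale_def strict_mono_def)

lemma gp_scale_gap:
  assumes "j < i"
  shows "(4320 * gp_scale j) ^ 2 \<le> gp_scale i" "4320 * gp_scale j < gp_scale i"
proof -
  have pos: "1 \<le> (4::nat) ^ j" by simp
  have "(4::nat) ^ Suc j \<le> 4 ^ i"
    using assms by (intro power_increasing) auto
  with pos have le: "2 + 2 * 4 ^ j \<le> (4::nat) ^ i" and less: "1 + 4 ^ j < (4::nat) ^ i"
    unfolding power_Suc by linarith+
  have "(4320 * gp_scale j) ^ 2 = 4320 ^ (2 + 2 * 4 ^ j)"
    by (simp add: gp_scale_def power_add power_mult_distrib flip: power_mult)
  also have "\<dots> \<le> gp_scale i"
    unfolding gp_scale_def using le by (intro power_increasing) auto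
  finally show "(4320 * gp_scale j) ^ 2 \<le> gp_scale i" .
  have "4320 * gp_scale j = 4320 ^ (1 + 4 ^ j)"
    by (simp add: gp_scale_def)
  also have "\<dots> < gp_scale i"
    unfolding gp_scale_def using less by (intro power_strict_increasing) auto
  finally show "4320 * gp_scale j < gp_scale i" .
qed

text \<open>The assumption holds once some element of block \<open>i\<close> is at most some element
  of block \<open>j\<close>.\<close>

lemma gp_scale_le:
  assumes "90 * gp_scale i \<le> 4320 * gp_scale j"
  shows "i \<le> j"
  using gp_scale_gap(2)[of j i] assms by (cases "j < i") auto

definition gp_free_set :: "nat set" where
  "gp_free_set = (\<Union>i. gp_block (gp_scale i))"

lemma gp_free_set_gp_free: "int_ratio_gp_free gp_free_set"
  unfolding int_ratio_gp_free_def
proof safe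
  fix a k :: nat
  assume a1: "a \<ge> 1" and k: "k \<ge> 2"
    and "a \<in> gp_free_set" "a * k \<in> gp_free_set" "a * k ^ 2 \<in> gp_free_set"
  then obtain h j i where a: "a \<in> gp_block (gp_scale h)"
    and b: "a * k \<in> gp_block (gp_scale j)" and c: "a * k ^ 2 \<in> gp_block (gp_scale i)"
    by (auto simp: gp_free_set_def)
  note bounds = gp_block_bounds[OF a] gp_block_bounds[OF b] gp_block_bounds[OF c]
  have bc: "a * k \<le> a * k ^ 2" and ab: "a \<le> a * k"
    using k by (auto simp: power2_eq_square)
  have "i \<le> j"
  proof (rule ccontr)
    assume "\<not> i \<le> j"
    have "gp_scale i < a * k ^ 2" using bounds by linarith
    also have "\<dots> \<le> a * (a * k ^ 2)"
      using a1 by simp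
    also have "\<dots> = (a * k) ^ 2"
      by (simp add: power2_eq_square)
    also have "\<dots> \<le> (4320 * gp_scale j) ^ 2"
      using bounds by (intro power_mono) auto
    also have "\<dots> \<le> gp_scale i"
      using \<open>\<not> i \<le> j\<close> by (intro gp_scale_gap) auto
    finally show False by simp
  qed
  moreover have "j \<le> i"
    using bounds bc gp_scale_le[of j i] by linarith
  ultimately have "j = i" by simp
  note bounds = bounds[unfolded this]
  have "k < 48"
  proof (rule ccontr)
    assume "\<not> k < 48"
    then have "a * k * 48 \<le> a * k * k" by (intro mult_left_mono) auto
    then have "48 * (a * k) \<le> a * k ^ 2" by (simp add: power2_eq_square mult_ac)
    then show False using bounds by linarith
  qed
  then have "a * k \<le> a * 48" by (intro mult_left_mono) auto
  \<comment> \<open>So \<open>a\<close> exceeds \<open>gp_scale i\<close>, while the blocks at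
    smaller scales lie below it.\<close>
  then have "90 * gp_scale i < 48 * a" using bounds by linarith
  then have "i \<le> h"
    using bounds gp_scale_gap(2)[of h i] by (cases "h < i") auto
  moreover have "h \<le> i"
    using bounds ab gp_scale_le[of h i] by linarith
  ultimately have "h = i" by simp
  then show False
    using gp_block_gp_free[of "gp_scale i"] a a1 b c k \<open>j = i\<close> by (auto simp: int_ratio_gp_free_def)
qed

lemma upper_density_gp_free_set: "ereal (3523 / 4320) \<le> upper_density gp_free_set"
proof -
  define f where "f N = ereal (real (card (gp_free_set \<inter> {1..N})) / real N)" for N
  have "ereal (3523 / 4320) \<le> f (4320 * gp_scale i)" for i
  proof -
    have pos: "0 < gp_scale i" by (simp add: gp_scale_def)
    \<comment> \<open>Block \<open>i\<close> alone attains the required proportion up to its right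
      end; smaller scales are discarded.\<close>
    have "gp_block (gp_scale i) \<subseteq> gp_free_set \<inter> {1..4320 * gp_scale i}"
      using gp_block_subset by (auto simp: gp_free_set_def)
    then have "3523 * gp_scale i \<le> card (gp_free_set \<inter> {1..4320 * gp_scale i})"
      by (metis card_gp_block card_mono finite_Int finite_atLeastAtMost)
    then have "real (3523 * gp_scale i) \<le> real (card (gp_free_set \<inter> {1..4320 * gp_scale i}))"
      by (rule of_nat_mono)
    with pos show ?thesis by (simp add: f_def field_simps)
  qed
  then have "ereal (3523 / 4320) \<le> limsup (f \<circ> (\<lambda>i. 4320 * gp_scale i))"
    by (intro le_Limsup) auto
  also have "\<dots> \<le> limsup f"
    using strict_mono_gp_scale by (intro limsup_subseq_mono) (simp add: strict_mono_def)
  finally show ?thesis unfolding upper_density_def f_def .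
qed

theorem theorem3p1:
  shows "(\<exists>A :: nat set. A \<subseteq> {1..} \<and> int_ratio_gp_free A \<and> upper_density A > ereal 0.815509)
         \<and> beta_bar > ereal 0.815509"
proof -
  have pos: "gp_free_set \<subseteq> {1..}"
    using gp_block_subset by (fastforce simp: gp_free_set_def)
  have "ereal 0.815509 < ereal (3523 / 4320)" by simp
  also note upper_density_gp_free_set
  finally have gt: "ereal 0.815509 < upper_density gp_free_set" .
  also have "\<dots> \<le> beta_bar"
    unfolding beta_bar_def using pos gp_free_set_gp_free by (intro SUP_upper) simp
  finally show ?thesis
    using pos gp_free_set_gp_free gt by blast
qed

end
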